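(* Let $n\ge 0$, let $p_0, p_1, \ldots,p_{n}$ and $q_0, q_1, \ldots,q_{n}$ be sequences of integers, let $\gamma$ be a real number, and let $\alpha_0,\alpha_1,\ldots, \alpha_{n}$ and $\beta_0,\beta_1,\ldots , \beta_{n}$ be sequences of real numbers. Then the determinant $$ \det \left[ \sum_{0\le m \le p_i+q_j} \binom{\alpha_i+\beta_j+\gamma m}{p_i+q_j-m}x^m \right]_{0 \leq i,j \leq n}, $$ as a polynomial in $x$, has degree at most $\max \{ \max_i{p_i} + \max_j{q_j} - n,\ 0 \}$.
   Context: An empty sum is zero (so the $(i,j)$ entry is $0$ when $p_i+q_j<0$). The binomial coefficients are interpreted via the gamma function; that is, for real $z$ and integer $k\ge 0$, $\binom{z}{k}=\frac{z(z-1)\cdots(z-k+1)}{k!}$. The zero polynomial is regarded as satisfying any such degree bound. *)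

theory Defs
  imports "Jordan_Normal_Form.Determinant"
begin

definition entry_poly :: "real \<Rightarrow> real \<Rightarrow> int \<Rightarrow> real poly" where
  "entry_poly \<gamma> a N = (\<Sum>m\<in>{0..N}. monom ((a + \<gamma> * of_int m) gchoose nat (N - m)) (nat m))"

end

theory Submission
  imports Defs "Jordan_Normal_Form.Char_Poly" "HOL-Computational_Algebra.Formal_Laurent_Series"
begin

text \<open>
  The idea is to look at the matrix near \<open>x = \<infinity>\<close>. Put \<open>s = 1/x\<close>, \<open>P = Max p\<close>,
  \<open>Q = Max q\<close> and \<open>T = P + Q\<close>. If \<open>T < 0\<close>, every entry vanishes; so let \<open>T \<ge> 0\<close>.
  Extending the sum that defines an entry from \<open>0 \<le> m \<le> N\<close> to all integers
  \<open>m \<le> N\<close>, where \<open>N = p i + q j\<close>, and substituting \<open>k = N - m\<close> turns it into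
  \<open>s\<close> to the power \<open>-N\<close> times \<open>G (\<alpha> i + \<beta> j + \<gamma> N)\<close>, where \<open>G c\<close> is the power series
  in \<open>s\<close> with coefficients \<open>(c - \<gamma> k) gchoose k\<close>. The added terms only involve
  positive powers of \<open>s\<close>.

  The series \<open>G\<close> is multiplicative up to normalisation,
  \<open>G c * G d = G (c + d) * G 0\<close> (\<open>gbin_fps_mult\<close>), and
  \<open>\<alpha> i + \<beta> j + \<gamma> N\<close> is a sum of a term depending on \<open>i\<close> and one depending on \<open>j\<close>.
  Hence the extended matrix has rank one: \<open>s ^ T\<close> times the original matrix equals
  \<open>u i * v j + s ^ (T + 1) * R i j\<close> for power series \<open>u i\<close>, \<open>v j\<close> and \<open>R i j\<close> in \<open>s\<close>
  (\<open>entry_poly_at_infinity\<close>).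

  The determinant of a rank-one matrix of size \<open>n + 1\<close> plus \<open>z\<close> times another matrix
  is divisible by \<open>z ^ n\<close> (\<open>dvd_det_rank_one_add_smult\<close>). With \<open>z = s ^ (T + 1)\<close> this
  shows that \<open>s ^ (T * (n + 1))\<close> times the determinant is divisible by
  \<open>s ^ ((T + 1) * n)\<close>, so a nonzero determinant has degree at most
  \<open>T * (n + 1) - (T + 1) * n = T - n\<close> in \<open>x\<close>.
\<close>

section \<open>The generalised binomial series\<close>

text \<open>
  The power series with coefficients \<open>(c + \<beta> k) gchoose k\<close>. With \<open>B\<close> the generalised
  binomial series of parameter \<open>\<beta>\<close>, it is \<open>B powr c\<close> times a factor independent of
  \<open>c\<close>; this explains \<open>gbin_fps_mult\<close> below.
\<close>

definition gbin_fps :: "real \<Rightarrow> real \<Rightarrow> real fps" where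
  "gbin_fps \<beta> c = Abs_fps (\<lambda>k. (c + \<beta> * of_nat k) gchoose k)"

lemma gbin_fps_add_one:
  "gbin_fps \<beta> (c + 1) = gbin_fps \<beta> c + fps_X * gbin_fps \<beta> (c + \<beta>)"
proof (rule fps_ext)
  fix k
  show "fps_nth (gbin_fps \<beta> (c + 1)) k
      = fps_nth (gbin_fps \<beta> c + fps_X * gbin_fps \<beta> (c + \<beta>)) k"
  proof (cases k)
    case (Suc m)
    have *: "c + 1 + \<beta> * of_nat (Suc m) = (c + \<beta> + \<beta> * of_nat m) + 1"
      "c + \<beta> * of_nat (Suc m) = c + \<beta> + \<beta> * of_nat m"
      by (simp_all add: algebra_simps)
    have "fps_nth (fps_X * gbin_fps \<beta> (c + \<beta>)) (Suc m) = (c + \<beta> + \<beta> * of_nat m) gchoose m"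
      by (simp add: gbin_fps_def)
    then show ?thesis
      unfolding Suc fps_add_nth gbin_fps_def fps_nth_Abs_fps * gbinomial_Suc_Suc by simp
  qed (simp add: gbin_fps_def)
qed

lemma gbinomial_affine_poly:
  "\<exists>P :: real poly. \<forall>h. poly P h = (a + e * h) gchoose k"
proof
  show "\<forall>h. poly (smult (1 / fact k) (\<Prod>i = 0..<k. [:a - of_nat i, e:])) h = (a + e * h) gchoose k"
    by (simp add: gbinomial_prod_rev poly_prod algebra_simps)
qed

lemma gbin_fps_mult_shift_poly:
  "\<exists>P :: real poly. \<forall>h. poly P h = fps_nth (gbin_fps \<beta> (c + h) * gbin_fps \<beta> (d - h)) k"
proof -
  have "\<exists>P :: real poly. \<forall>h. poly P h = (c + \<beta> * of_nat i + 1 * h) gchoose i" for i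
    by (rule gbinomial_affine_poly)
  then obtain P :: "nat \<Rightarrow> real poly"
    where P: "\<And>i h. poly (P i) h = (c + \<beta> * of_nat i + 1 * h) gchoose i" by metis
  have "\<exists>P :: real poly. \<forall>h. poly P h = (d + \<beta> * of_nat i + (-1) * h) gchoose i" for i
    by (rule gbinomial_affine_poly)
  then obtain Q :: "nat \<Rightarrow> real poly"
    where Q: "\<And>i h. poly (Q i) h = (d + \<beta> * of_nat i + (-1) * h) gchoose i" by metis
  have "poly (\<Sum>i=0..k. P i * Q (k - i)) h
      = fps_nth (gbin_fps \<beta> (c + h) * gbin_fps \<beta> (d - h)) k" for h
    unfolding poly_sum poly_mult P Q fps_mult_nth gbin_fps_def fps_nth_Abs_fps
    by (intro sum.cong refl arg_cong2[of _ _ _ _ "(*)"] arg_cong2[of _ _ _ _ "(gchoose)"]) simp_all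
  then show ?thesis by (intro exI allI)
qed

text \<open>
  Jensen's convolution identity: the coefficients of the product depend on \<open>c\<close> and \<open>d\<close>
  only through \<open>c + d\<close>. The recurrence \<open>gbin_fps_add_one\<close> reduces a shift by one to a
  shift by \<open>\<beta>\<close> in the preceding coefficient, which is covered by the induction
  hypothesis for arbitrary real shifts. The passage from shifts by natural numbers to real
  shifts is possible because both sides are polynomials in the shift.
\<close>

lemma gbin_fps_mult_shift_nth:
  "fps_nth (gbin_fps \<beta> (c + h) * gbin_fps \<beta> (d - h)) k
   = fps_nth (gbin_fps \<beta> c * gbin_fps \<beta> d) k"
proof (induction k arbitrary: c d h)
  case 0
  show ?case by (simp add: gbin_fps_def)
next
  case (Suc k)
  have unit: "fps_nth (gbin_fps \<beta> (c + 1) * gbin_fps \<beta> d) (Suc k)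
            = fps_nth (gbin_fps \<beta> c * gbin_fps \<beta> (d + 1)) (Suc k)" for c d
  proof -
    have "gbin_fps \<beta> (c + 1) * gbin_fps \<beta> d - gbin_fps \<beta> c * gbin_fps \<beta> (d + 1)
        = fps_X * (gbin_fps \<beta> (c + \<beta>) * gbin_fps \<beta> d - gbin_fps \<beta> c * gbin_fps \<beta> (d + \<beta>))"
      unfolding gbin_fps_add_one by (simp add: algebra_simps)
    then have "fps_nth (gbin_fps \<beta> (c + 1) * gbin_fps \<beta> d - gbin_fps \<beta> c * gbin_fps \<beta> (d + 1)) (Suc k)
        = fps_nth (gbin_fps \<beta> (c + \<beta>) * gbin_fps \<beta> d - gbin_fps \<beta> c * gbin_fps \<beta> (d + \<beta>)) k"
      by simp
    also have "\<dots> = 0"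
      using Suc[of c \<beta> "d + \<beta>"] by simp
    finally show ?thesis by simp
  qed
  have int_shift: "fps_nth (gbin_fps \<beta> (c + of_nat m) * gbin_fps \<beta> (d - of_nat m)) (Suc k)
      = fps_nth (gbin_fps \<beta> c * gbin_fps \<beta> d) (Suc k)" for m
  proof (induction m)
    case (Suc m)
    from unit[of "c + of_nat m" "d - of_nat (Suc m)"] Suc.IH show ?case
      by (simp add: algebra_simps)
  qed simp
  obtain P :: "real poly" where
    P: "\<And>h. poly P h = fps_nth (gbin_fps \<beta> (c + h) * gbin_fps \<beta> (d - h)) (Suc k)"
    using gbin_fps_mult_shift_poly by metis
  let ?P = "P - [:fps_nth (gbin_fps \<beta> c * gbin_fps \<beta> d) (Suc k):]"
  \<comment> \<open>A polynomial with all natural numbers among its roots vanishes.\<close>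
  have "range real \<subseteq> {x. poly ?P x = 0}"
    using int_shift by (auto simp: P)
  moreover have "infinite (range real)"
    by (simp add: finite_image_iff inj_on_def)
  ultimately have "?P = 0"
    using poly_roots_finite finite_subset by blast
  then have "poly ?P h = 0" by simp
  then show ?case by (simp add: P)
qed

lemma gbin_fps_mult:
  "gbin_fps \<beta> c * gbin_fps \<beta> d = gbin_fps \<beta> (c + d) * gbin_fps \<beta> 0"
  by (rule fps_ext) (use gbin_fps_mult_shift_nth[of \<beta> c d d] in simp)

lemma gbin_fps_add:
  "gbin_fps \<beta> (c + d) = gbin_fps \<beta> c * (gbin_fps \<beta> d * inverse (gbin_fps \<beta> 0))"
proof -
  have "gbin_fps \<beta> 0 * inverse (gbin_fps \<beta> 0) = 1"
    by (intro inverse_mult_eq_1') (simp add: gbin_fps_def)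
  then show ?thesis
    using gbin_fps_mult[of \<beta> c d] by (simp add: mult.assoc[symmetric])
qed

section \<open>Determinants of perturbed rank-one matrices\<close>

text \<open>
  The bordered matrix with corner \<open>z\<close>, top row \<open>- z v\<close>, left column \<open>u\<close> and block
  \<open>z R\<close> is factored in two ways. Splitting off the rank-one part gives determinant
  \<open>z\<close> times the determinant in question; taking \<open>z\<close> out of the last \<open>n + 1\<close> columns
  gives a multiple of \<open>z ^ (n + 1)\<close>. Cancelling \<open>z\<close> yields the claim.
\<close>

lemma dvd_det_rank_one_add_smult:
  fixes z :: "'a :: idom" and u v :: "nat \<Rightarrow> 'a" and R :: "nat \<Rightarrow> nat \<Rightarrow> 'a"
  assumes "z \<noteq> 0"
  shows "z ^ n dvd det (mat (n + 1) (n + 1) (\<lambda>(i, j). u i * v j + z * R i j))"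
    (is "_ dvd det ?M")
proof -
  let ?n = "n + 1"
  let ?z = "mat 1 1 (\<lambda>_. z)"
  let ?u = "mat ?n 1 (\<lambda>(i, j). u i)"
  let ?v = "mat 1 ?n (\<lambda>(i, j). - v j)"
  let ?R = "mat ?n ?n (\<lambda>(i, j). R i j)"
  let ?X = "four_block_mat ?z ?v ?u ?R"
  have "four_block_mat ?z (0\<^sub>m 1 ?n) ?u (1\<^sub>m ?n) * four_block_mat (1\<^sub>m 1) ?v (0\<^sub>m ?n 1) ?M
      = four_block_mat (?z * 1\<^sub>m 1 + 0\<^sub>m 1 ?n * 0\<^sub>m ?n 1) (?z * ?v + 0\<^sub>m 1 ?n * ?M)
          (?u * 1\<^sub>m 1 + 1\<^sub>m ?n * 0\<^sub>m ?n 1) (?u * ?v + 1\<^sub>m ?n * ?M)"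
    by (rule mult_four_block_mat) auto
  also have "?z * 1\<^sub>m 1 + 0\<^sub>m 1 ?n * 0\<^sub>m ?n 1 = ?z"
    by (rule eq_matI) (auto simp: scalar_prod_def)
  also have "?z * ?v + 0\<^sub>m 1 ?n * ?M = z \<cdot>\<^sub>m ?v"
    by (rule eq_matI) (auto simp: scalar_prod_def)
  also have "?u * 1\<^sub>m 1 + 1\<^sub>m ?n * 0\<^sub>m ?n 1 = ?u"
    by (rule eq_matI) (auto simp: scalar_prod_def)
  also have "?u * ?v + 1\<^sub>m ?n * ?M = z \<cdot>\<^sub>m ?R"
    by (subst left_mult_one_mat[of _ ?n ?n], simp, rule eq_matI) (auto simp: scalar_prod_def)
  also have "four_block_mat ?z (z \<cdot>\<^sub>m ?v) ?u (z \<cdot>\<^sub>m ?R)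
      = four_block_mat (?z * 1\<^sub>m 1 + ?v * 0\<^sub>m ?n 1) (?z * 0\<^sub>m 1 ?n + ?v * (z \<cdot>\<^sub>m 1\<^sub>m ?n))
          (?u * 1\<^sub>m 1 + ?R * 0\<^sub>m ?n 1) (?u * 0\<^sub>m 1 ?n + ?R * (z \<cdot>\<^sub>m 1\<^sub>m ?n))"
  proof -
    have "?z * 1\<^sub>m 1 + ?v * 0\<^sub>m ?n 1 = ?z" "?u * 1\<^sub>m 1 + ?R * 0\<^sub>m ?n 1 = ?u"
      by (auto intro!: eq_matI simp: scalar_prod_def)
    moreover have "?v * (z \<cdot>\<^sub>m 1\<^sub>m ?n) = z \<cdot>\<^sub>m ?v" "?R * (z \<cdot>\<^sub>m 1\<^sub>m ?n) = z \<cdot>\<^sub>m ?R"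
      using mult_smult_distrib[of ?v 1 ?n "1\<^sub>m ?n" ?n z] right_mult_one_mat[of ?v 1 ?n]
        mult_smult_distrib[of ?R ?n ?n "1\<^sub>m ?n" ?n z] right_mult_one_mat[of ?R ?n ?n]
      by simp_all
    ultimately show ?thesis
      by (simp add: left_add_zero_mat[of _ 1 ?n] left_add_zero_mat[of _ ?n ?n]
          right_mult_zero_mat[of _ 1 1] right_mult_zero_mat[of _ ?n 1])
  qed
  also have "\<dots> = ?X * four_block_mat (1\<^sub>m 1) (0\<^sub>m 1 ?n) (0\<^sub>m ?n 1) (z \<cdot>\<^sub>m 1\<^sub>m ?n)"
    by (rule mult_four_block_mat[symmetric]) auto
  finally have "det (four_block_mat ?z (0\<^sub>m 1 ?n) ?u (1\<^sub>m ?n)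
        * four_block_mat (1\<^sub>m 1) ?v (0\<^sub>m ?n 1) ?M)
      = det (?X * four_block_mat (1\<^sub>m 1) (0\<^sub>m 1 ?n) (0\<^sub>m ?n 1) (z \<cdot>\<^sub>m 1\<^sub>m ?n))"
    by simp
  moreover have "det (four_block_mat ?z (0\<^sub>m 1 ?n) ?u (1\<^sub>m ?n)
        * four_block_mat (1\<^sub>m 1) ?v (0\<^sub>m ?n 1) ?M) = z * det ?M"
  proof -
    have "det (four_block_mat ?z (0\<^sub>m 1 ?n) ?u (1\<^sub>m ?n)) = det ?z * det (1\<^sub>m ?n)"
      by (rule det_four_block_mat_upper_right_zero) auto
    moreover have "det (four_block_mat (1\<^sub>m 1) ?v (0\<^sub>m ?n 1) ?M) = det (1\<^sub>m 1) * det ?M"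
      by (rule det_four_block_mat_lower_left_zero) auto
    moreover have "det ?z = z"
      by (simp add: det_single)
    ultimately show ?thesis
      by (subst det_mult[of _ "1 + ?n"]) (rule four_block_carrier_mat, simp, simp | simp)+
  qed
  moreover have "det (?X * four_block_mat (1\<^sub>m 1) (0\<^sub>m 1 ?n) (0\<^sub>m ?n 1) (z \<cdot>\<^sub>m 1\<^sub>m ?n))
      = det ?X * z ^ ?n"
  proof -
    have "det (four_block_mat (1\<^sub>m 1) (0\<^sub>m 1 ?n) (0\<^sub>m ?n 1) (z \<cdot>\<^sub>m 1\<^sub>m ?n))
        = det (1\<^sub>m 1) * det (z \<cdot>\<^sub>m 1\<^sub>m ?n)"
      by (rule det_four_block_mat_upper_right_zero) auto
    then show ?thesis
      by (subst det_mult[of _ "1 + ?n"]) (rule four_block_carrier_mat, simp, simp | simp)+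
  qed
  ultimately have "z * det ?M = z * (z ^ n * det ?X)"
    by (simp add: algebra_simps)
  with assms have "det ?M = z ^ n * det ?X" by simp
  then show ?thesis by simp
qed

section \<open>Polynomials as Laurent series at infinity\<close>

text \<open>
  The expansion of a polynomial at infinity: \<open>p\<close> is evaluated at the inverse of the
  variable of the Laurent series, so that the degree of \<open>p\<close> becomes the order of a pole.
\<close>

definition at_infinity_fls :: "real poly \<Rightarrow> real fls" where
  "at_infinity_fls p = poly (map_poly fls_const p) fls_X_inv"

interpretation fls_const: comm_ring_hom "fls_const :: real \<Rightarrow> real fls"
  by unfold_locales (simp_all add: fls_plus_const)

interpretation map_fls_const: map_poly_comm_ring_hom "fls_const :: real \<Rightarrow> real fls" ..

interpretation at_infinity_fls: comm_ring_hom at_infinity_fls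
  by unfold_locales
    (simp_all add: at_infinity_fls_def hom_distribs)

lemma fls_nth_at_infinity_fls:
  "fls_nth (at_infinity_fls p) k = (if k \<le> 0 then coeff p (nat (- k)) else 0)"
proof -
  have *: "fls_nth (at_infinity_fls p) k
      = (\<Sum>i\<le>degree p. if k = - int i then coeff p i else 0)"
    unfolding at_infinity_fls_def fls_const.poly_map_poly_eval_poly
    by (auto simp: eval_poly_as_sum fls_nth_sum mult.commute intro!: sum.cong)
  show ?thesis
  proof (cases "k \<le> 0")
    case True
    then have "(k = - int i) = (i = nat (- k))" for i by auto
    with True show ?thesis
      by (auto simp: * coeff_eq_0)
  next
    case False
    then have "k \<noteq> - int i" for i by auto
    with False show ?thesis by (simp add: *)
  qed
qed

lemma degree_add_le_if_fls_X_power_mult: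
  assumes "p \<noteq> 0"
    and "fls_X ^ a * at_infinity_fls p = fps_to_fls (fps_X ^ b * f)"
  shows "degree p + b \<le> a"
proof (rule ccontr)
  assume "\<not> ?thesis"
  then have less: "int a - int (degree p) < int b" by simp
  have "fls_nth (fls_X ^ a * at_infinity_fls p) (int a - int (degree p)) = lead_coeff p"
    by (simp add: fls_X_power_times_conv_shift fls_nth_at_infinity_fls)
  moreover have "fls_nth (fps_to_fls (fps_X ^ b * f)) (int a - int (degree p)) = 0"
    using less by (auto simp: fps_X_power_mult_nth)
  ultimately show False using assms by simp
qed

section \<open>Expansion of the entries and the degree bound\<close>

lemma coeff_entry_poly:
  "coeff (entry_poly \<gamma> a N) m
   = (if int m \<le> N then (a + \<gamma> * of_nat m) gchoose nat (N - int m) else 0)"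
proof -
  have "coeff (entry_poly \<gamma> a N) m
      = (\<Sum>k\<in>{0..N}. if k = int m then (a + \<gamma> * of_int k) gchoose nat (N - k) else 0)"
    unfolding entry_poly_def coeff_sum by (intro sum.cong) auto
  then show ?thesis by simp
qed

text \<open>
  Up to an error divisible by \<open>fps_X ^ (T + 1)\<close>, the entry multiplied by \<open>fps_X ^ T\<close> is
  given by the complete binomial series, since its terms beyond those of the entry have exponent
  greater than \<open>T\<close>. The integer \<open>N\<close> may be negative, in which case the entry is zero and
  all terms of the series belong to the error.
\<close>

lemma entry_poly_at_infinity:
  assumes "N \<le> int T"
  shows "\<exists>R. fls_X ^ T * at_infinity_fls (entry_poly \<gamma> a N)
    = fps_to_fls (fps_X ^ nat (int T - N) * gbin_fps (- \<gamma>) (a + \<gamma> * of_int N)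
        + fps_X ^ (T + 1) * R)"
proof -
  let ?F = "fps_X ^ nat (int T - N) * gbin_fps (- \<gamma>) (a + \<gamma> * of_int N)"
  let ?R = "- Abs_fps (\<lambda>k. fps_nth ?F (k + (T + 1)))"
  have low: "fps_nth ?F m = coeff (entry_poly \<gamma> a N) (T - m)" if "m \<le> T" for m
  proof (cases "int m < int T - N")
    case True
    then show ?thesis using that by (simp add: fps_X_power_mult_nth coeff_entry_poly)
  next
    case False
    define k where "k = m - nat (int T - N)"
    have k: "int k = int m - (int T - N)" using False assms unfolding k_def by auto
    have "real_of_int N - real k = real (T - m)"
      using that arg_cong[OF k, of real_of_int] by simp
    then have "a + \<gamma> * of_int N + - \<gamma> * of_nat k = a + \<gamma> * of_nat (T - m)"
      by (simp add: algebra_simps flip: distrib_left right_diff_distrib)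
    moreover have "nat (N - int (T - m)) = k" using that k by simp
    moreover have "fps_nth ?F m = (a + \<gamma> * of_int N + - \<gamma> * of_nat k) gchoose k"
    proof -
      have "\<not> m < nat (int T - N)" using False by linarith
      then show ?thesis
        unfolding fps_X_power_mult_nth k_def[symmetric] gbin_fps_def by simp
    qed
    moreover have "int (T - m) \<le> N" using False that by linarith
    ultimately show ?thesis by (simp only: coeff_entry_poly if_True)
  qed
  have "fls_nth (fls_X ^ T * at_infinity_fls (entry_poly \<gamma> a N)) j
      = fls_nth (fps_to_fls (?F + fps_X ^ (T + 1) * ?R)) j" for j
  proof -
    consider "j < 0" | "0 \<le> j" "j \<le> int T" | "int T < j" by linarith
    then show ?thesis
    proof cases
      case 1
      then show ?thesis using assms
        by (simp add: fls_X_power_times_conv_shift fls_nth_at_infinity_fls coeff_entry_poly)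
    next
      case 2
      then obtain m where m: "j = int m" "m \<le> T" by (metis nat_0_le of_nat_le_iff)
      have "nat (- (int m - int T)) = T - m" by simp
      moreover have "fps_nth (fps_X ^ (T + 1) * ?R) m = 0"
        using m(2) by (simp only: fps_X_power_mult_nth) simp
      ultimately show ?thesis unfolding m(1) using m(2) low[OF m(2)]
        by (simp add: fls_X_power_times_conv_shift fls_nth_at_infinity_fls del: power_Suc)
    next
      case 3
      define m where "m = nat j - (T + 1)"
      have m: "j = int (m + (T + 1))" using 3 unfolding m_def by simp
      have "fps_nth (fps_X ^ (T + 1) * ?R) (m + (T + 1)) = - fps_nth ?F (m + (T + 1))"
        by (simp only: fps_X_power_mult_nth) simp
      then have "fps_nth (?F + fps_X ^ (T + 1) * ?R) (m + (T + 1)) = 0"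
        by (simp only: fps_add_nth)
      then have "fls_nth (fps_to_fls (?F + fps_X ^ (T + 1) * ?R)) j = 0"
        unfolding m fps_to_fls_nth nat_int by simp
      moreover have "fls_nth (fls_X ^ T * at_infinity_fls (entry_poly \<gamma> a N)) j = 0"
        using 3 by (simp add: fls_X_power_times_conv_shift fls_nth_at_infinity_fls)
      ultimately show ?thesis by (simp only:)
    qed
  qed
  then show ?thesis by (intro exI[of _ ?R] fls_eqI) blast
qed

theorem theorem11:
  fixes n :: nat
    and p q :: "nat \<Rightarrow> int"
    and \<gamma> :: real
    and \<alpha> \<beta> :: "nat \<Rightarrow> real"
  shows "int (degree (det (mat (n + 1) (n + 1)
            (\<lambda>(i, j). entry_poly \<gamma> (\<alpha> i + \<beta> j) (p i + q j)))))
         \<le> max (Max (p ` {0..n}) + Max (q ` {0..n}) - int n) 0"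
proof -
  let ?M = "mat (n + 1) (n + 1) (\<lambda>(i, j). entry_poly \<gamma> (\<alpha> i + \<beta> j) (p i + q j))"
  define P where "P = Max (p ` {0..n})"
  define Q where "Q = Max (q ` {0..n})"
  have pP: "p i \<le> P" and qQ: "q i \<le> Q" if "i \<le> n" for i
    using that unfolding P_def Q_def by auto
  show ?thesis unfolding P_def[symmetric] Q_def[symmetric]
  proof (cases "det ?M = 0")
    case False
    \<comment> \<open>Otherwise all entries are empty sums.\<close>
    have "0 \<le> P + Q"
    proof (rule ccontr)
      assume neg: "\<not> 0 \<le> P + Q"
      have "?M = 0\<^sub>m (n + 1) (n + 1)"
      proof (rule eq_matI)
        fix i j assume "i < dim_row (0\<^sub>m (n + 1) (n + 1))" "j < dim_col (0\<^sub>m (n + 1) (n + 1))"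
        then have "i \<le> n" "j \<le> n" by auto
        with pP[of i] qQ[of j] neg show "?M $$ (i, j) = 0\<^sub>m (n + 1) (n + 1) $$ (i, j)"
          by (simp add: entry_poly_def)
      qed auto
      with False show False by simp
    qed
    define T where "T = nat (P + Q)"
    have T: "int T = P + Q" using \<open>0 \<le> P + Q\<close> unfolding T_def by simp
    define G where "G = gbin_fps (- \<gamma>)"
    \<comment> \<open>The exponent \<open>T - (p i + q j)\<close> of the leading power splits into the nonnegative
      parts \<open>P - p i\<close> and \<open>Q - q j\<close>.\<close>
    define u where "u i = fps_X ^ nat (P - p i) * G (\<alpha> i + \<gamma> * of_int (p i))" for i
    define v where "v j = fps_X ^ nat (Q - q j) * (G (\<beta> j + \<gamma> * of_int (q j)) * inverse (G 0))" for j
    have "\<exists>R. fls_X ^ T * at_infinity_fls (entry_poly \<gamma> (\<alpha> i + \<beta> j) (p i + q j))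
        = fps_to_fls (u i * v j + fps_X ^ (T + 1) * R)" if "i \<le> n" "j \<le> n" for i j
    proof -
      have "nat (int T - (p i + q j)) = nat (P - p i) + nat (Q - q j)"
        using pP[OF that(1)] qQ[OF that(2)] T by simp
      moreover have "\<alpha> i + \<beta> j + \<gamma> * of_int (p i + q j)
          = (\<alpha> i + \<gamma> * of_int (p i)) + (\<beta> j + \<gamma> * of_int (q j))"
        by (simp add: algebra_simps)
      ultimately have "fps_X ^ nat (int T - (p i + q j)) * G (\<alpha> i + \<beta> j + \<gamma> * of_int (p i + q j))
          = u i * v j"
        unfolding u_def v_def G_def by (simp only: gbin_fps_add power_add) (simp only: ac_simps)
      then show ?thesis
        using entry_poly_at_infinity[of "p i + q j" T \<gamma> "\<alpha> i + \<beta> j"]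
          pP[OF that(1)] qQ[OF that(2)] T unfolding G_def by simp
    qed
    then obtain R where R: "\<And>i j. i \<le> n \<Longrightarrow> j \<le> n \<Longrightarrow>
        fls_X ^ T * at_infinity_fls (entry_poly \<gamma> (\<alpha> i + \<beta> j) (p i + q j))
        = fps_to_fls (u i * v j + fps_X ^ (T + 1) * R i j)" by metis
    let ?F = "mat (n + 1) (n + 1) (\<lambda>(i, j). u i * v j + fps_X ^ (T + 1) * R i j)"
    interpret fps_to_fls: comm_ring_hom "fps_to_fls :: real fps \<Rightarrow> real fls"
      by unfold_locales (simp_all add: fls_times_fps_to_fls)
    have "fls_X ^ T \<cdot>\<^sub>m map_mat at_infinity_fls ?M = map_mat fps_to_fls ?F"
      by (rule eq_matI) (auto simp: R less_Suc_eq_le)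
    then have "det (fls_X ^ T \<cdot>\<^sub>m map_mat at_infinity_fls ?M) = det (map_mat fps_to_fls ?F)"
      by simp
    then have fls_eq: "fls_X ^ (T * (n + 1)) * at_infinity_fls (det ?M) = fps_to_fls (det ?F)"
      unfolding det_smult at_infinity_fls.hom_det fps_to_fls.hom_det
      by (simp only: power_mult dim_col_mat index_map_mat)
    have "fps_X ^ ((T + 1) * n) dvd det ?F"
      unfolding power_mult by (rule dvd_det_rank_one_add_smult) simp
    then obtain W where "det ?F = fps_X ^ ((T + 1) * n) * W" by (elim dvdE)
    then have "fls_X ^ (T * (n + 1)) * at_infinity_fls (det ?M)
        = fps_to_fls (fps_X ^ ((T + 1) * n) * W)"
      using fls_eq by (simp only:)
    then have "degree (det ?M) + (T + 1) * n \<le> T * (n + 1)"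
      by (rule degree_add_le_if_fls_X_power_mult[OF False])
    then have "degree (det ?M) + n \<le> T" by simp
    then show "int (degree (det ?M)) \<le> max (P + Q - int n) 0"
      using T by linarith
  qed simp
qed

end
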